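(* Let $A\in M_n(\mathbb{C})$, let $\lambda$ be an eigenvalue of $A$ with a Jordan block $J_r(\lambda)$ of size $r$, and let $x_1,\dots,x_r$ be a Jordan chain of $A$ for this block. Let $1\le m\le r$ be an integer and $b\in\mathbb{C}^n$. Suppose an eigenvalue $\mu\ne\lambda$ of $A$ has a Jordan block of size $\gamma$, and let $z_1,\dots,z_\gamma$ be a Jordan chain of $A$ for this block. Assume $$(\mu-\lambda)^{m+1}-\sum_{j=1}^m(\mu-\lambda)^j(b^*x_j)\neq0 .$$ Then for every integer $1\le t\le\gamma$, $A+x_mb^*$ has a generalized eigenvector of rank $t$ associated with $\mu$, given by $$w_t=z_t+\sum_{j=1}^m\beta_j^{(t)}x_j,$$ where the coefficients $\beta_j^{(t)}$ satisfy the recurrence $$\beta_j^{(t)}=(\mu-\lambda)^{j-m}\left(\beta_m^{(t)}-\sum_{i=0}^{m-1-j}(\mu-\lambda)^i\beta_{m-1-i}^{(t-1)}\right),\qquad 1\le j\le m-1,$$ with $$\beta_m^{(t)}=\frac{(\mu-\lambda)^m\left(b^*z_t-\beta_m^{(t-1)}\right)-\sum_{j=1}^m(b^*x_j)\sum_{i=0}^{m-1-j}(\mu-\lambda)^{i+j}\beta_{m-1-i}^{(t-1)}}{(\mu-\lambda)^{m+1}-\sum_{j=1}^m(\mu-\lambda)^j(b^*x_j)} .$$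
   Context: $b^*$ denotes the conjugate transpose of $b$. A vector $x$ is a generalized eigenvector of rank $k$ of a matrix $M$ for the eigenvalue $\nu$ if $(M-\nu I)^k x=0$ and $(M-\nu I)^{k-1}x\neq0$. The chains consist of generalized eigenvectors $x_j$, $z_j$ of $A$ of rank $j$ with $Ax_j=\lambda x_j+x_{j-1}$ ($1\le j\le r$) and $Az_j=\mu z_j+z_{j-1}$ ($1\le j\le\gamma$), where $x_0=z_0=0$. The scalars $\beta_j^{(t)}$ are defined recursively in $t$; any scalar or vector with a subscript or superscript $0$ is $0$ (in particular $\beta_j^{(0)}=0$ for all $j$), and empty sums (e.g. the inner sum when $j=m$) are $0$. *)

theory Defs
  imports Complex_Main
    "Jordan_Normal_Form.Jordan_Normal_Form"
    "Jordan_Normal_Form.Schur_Decomposition"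
begin

(* No separate condition k >= 1 is needed: for k = 0 the two (in)equations
   contradict each other, since k - 1 = 0 on nat. *)
definition generalized_eigenvector :: "complex mat \<Rightarrow> complex \<Rightarrow> nat \<Rightarrow> complex vec \<Rightarrow> bool" where
  "generalized_eigenvector M \<nu> k x \<longleftrightarrow>
     (let n = dim_row M in
        M \<in> carrier_mat n n \<and> x \<in> carrier_vec n \<and>
        (M - \<nu> \<cdot>\<^sub>m 1\<^sub>m n) ^\<^sub>m k *\<^sub>v x = 0\<^sub>v n \<and>
        (M - \<nu> \<cdot>\<^sub>m 1\<^sub>m n) ^\<^sub>m (k - 1) *\<^sub>v x \<noteq> 0\<^sub>v n)"

definition has_jordan_block :: "complex mat \<Rightarrow> complex \<Rightarrow> nat \<Rightarrow> bool" where
  "has_jordan_block A \<nu> k \<longleftrightarrow> (\<exists>n_as. jordan_nf A n_as \<and> (k, \<nu>) \<in> set n_as)"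

(* A chain x 1, ..., x k is extended by x 0 = 0; values x j with j > k are irrelevant. *)
definition jordan_chain :: "complex mat \<Rightarrow> complex \<Rightarrow> nat \<Rightarrow> (nat \<Rightarrow> complex vec) \<Rightarrow> bool" where
  "jordan_chain A \<nu> k x \<longleftrightarrow>
     x 0 = 0\<^sub>v (dim_row A) \<and>
     (\<forall>j\<in>{1..k}. generalized_eigenvector A \<nu> j (x j) \<and>
                 A *\<^sub>v x j = \<nu> \<cdot>\<^sub>v x j + x (j - 1))"

(* The matrix x b^*, with x and b regarded as columns. The scalar b^* x is
   x \<bullet>c b, as the library's product conjugates its second argument. *)
definition rank_one :: "complex vec \<Rightarrow> complex vec \<Rightarrow> complex mat" where
  "rank_one x b = mat_of_cols (dim_vec x) [x] * mat_adjoint (mat_of_cols (dim_vec b) [b])"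

(* chain_coeff d m p q t j is the coefficient beta_j^(t), where d = mu - lambda,
   p j = b^* x_j and q t = b^* z_t. The sums over i = 0, ..., m-1-j are written
   over i < m - j, so that they are empty for j = m in spite of truncated
   subtraction. Coefficients with j = 0 or j > m are set to 0. *)
primrec chain_coeff ::
  "complex \<Rightarrow> nat \<Rightarrow> (nat \<Rightarrow> complex) \<Rightarrow> (nat \<Rightarrow> complex) \<Rightarrow> nat \<Rightarrow> nat \<Rightarrow> complex" where
  "chain_coeff d m p q 0 = (\<lambda>j. 0)"
| "chain_coeff d m p q (Suc t) =
     (let \<beta>' = chain_coeff d m p q t;
          \<beta>m = (d ^ m * (q (Suc t) - \<beta>' m)
                 - (\<Sum>j=1..m. p j * (\<Sum>i<m - j. d ^ (i + j) * \<beta>' (m - 1 - i))))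
               / (d ^ (m + 1) - (\<Sum>j=1..m. d ^ j * p j))
      in (\<lambda>j. if j = m then \<beta>m
              else if 1 \<le> j \<and> j < m
                then d powi (int j - int m) * (\<beta>m - (\<Sum>i<m - j. d ^ i * \<beta>' (m - 1 - i)))
              else 0))"

end

(* Writing B = A + x_m b^* - mu I, comparison of coefficients shows that the recurrence for the
   beta_j^(t) is equivalent to B w_t = w_(t-1) with w_0 = 0. Hence B^t w_t = 0 and
   B^(t-1) w_t = w_1, and w_1 is nonzero: (A - lam I)^m annihilates x_1, ..., x_m but multiplies
   the eigenvector z_1 by (mu - lam)^m. *)

theory Submission
  imports Defs
begin

section \<open>Linearity over finite vector sums and the action of rank-one matrices\<close>

lemma mult_mat_vec_finsum_vec:
  fixes M :: "'a :: comm_semiring_1 mat"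
  assumes M: "M \<in> carrier_mat nr nc" and "finite F" and "\<And>i. i \<in> F \<Longrightarrow> f i \<in> carrier_vec nc"
  shows "M *\<^sub>v finsum_vec TYPE('a) nc f F = finsum_vec TYPE('a) nr (\<lambda>i. M *\<^sub>v f i) F"
  using assms(2,3)
proof (induction F rule: finite_induct)
  case empty
  then show ?case using M by (auto simp: finsum_vec_empty)
next
  case (insert k F)
  have 1: "f \<in> F \<rightarrow> carrier_vec nc" "f k \<in> carrier_vec nc" using insert.prems by auto
  have 2: "(\<lambda>i. M *\<^sub>v f i) \<in> F \<rightarrow> carrier_vec nr" "M *\<^sub>v f k \<in> carrier_vec nr"
    using 1 by (auto intro!: mult_mat_vec_carrier[OF M])
  show ?case
    unfolding finsum_vec_insert[OF insert.hyps 1] finsum_vec_insert[OF insert.hyps 2]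
    using insert.IH insert.prems finsum_vec_closed[OF 1(1)]
    by (simp add: mult_add_distrib_mat_vec[OF M 1(2)])
qed

lemma finsum_vec_scalar_prod:
  fixes c :: "'a :: comm_semiring_0 vec"
  assumes c: "c \<in> carrier_vec n" and "finite F" and "\<And>i. i \<in> F \<Longrightarrow> f i \<in> carrier_vec n"
  shows "finsum_vec TYPE('a) n f F \<bullet> c = (\<Sum>i\<in>F. f i \<bullet> c)"
  using assms(2,3)
proof (induction F rule: finite_induct)
  case empty
  then show ?case using c by (auto simp: finsum_vec_empty)
next
  case (insert k F)
  have 1: "f \<in> F \<rightarrow> carrier_vec n" "f k \<in> carrier_vec n" using insert.prems by auto
  show ?case
    unfolding finsum_vec_insert[OF insert.hyps 1]
    using insert finsum_vec_closed[OF 1(1)] c 1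
    by (simp add: add_scalar_prod_distrib[of _ n])
qed

lemma rank_one_carrier [simp]:
  "x \<in> carrier_vec n \<Longrightarrow> b \<in> carrier_vec n \<Longrightarrow> rank_one x b \<in> carrier_mat n n"
  by (auto simp: rank_one_def mat_adjoint_def)

text \<open>Row i of \<open>rank_one x b\<close> is x_i times the conjugate of b, so pairing it with
  v leaves x_i times the scalar b^* v.\<close>

lemma rank_one_mult_vec:
  assumes "x \<in> carrier_vec n" "b \<in> carrier_vec n" "v \<in> carrier_vec n"
  shows "rank_one x b *\<^sub>v v = (v \<bullet>c b) \<cdot>\<^sub>v x"
proof (rule eq_vecI)
  fix i assume "i < dim_vec ((v \<bullet>c b) \<cdot>\<^sub>v x)"
  then have i: "i < n" using assms by simp
  have "row (rank_one x b) i = x $ i \<cdot>\<^sub>v conjugate b"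
    using assms i
    by (intro eq_vecI) (auto simp: rank_one_def mat_adjoint_def scalar_prod_def mat_of_rows_def
        mat_of_cols_def)
  then show "(rank_one x b *\<^sub>v v) $ i = ((v \<bullet>c b) \<cdot>\<^sub>v x) $ i"
    using assms i carrier_matD[OF rank_one_carrier[OF assms(1,2)]]
    by (simp add: comm_scalar_prod[of v n])
qed (use assms carrier_matD[OF rank_one_carrier[OF assms(1,2)]] in auto)

lemma minus_smult_one_mult_vec:
  fixes M :: "'a :: comm_ring_1 mat"
  assumes "M \<in> carrier_mat n n" "v \<in> carrier_vec n"
  shows "(M - \<nu> \<cdot>\<^sub>m 1\<^sub>m n) *\<^sub>v v = M *\<^sub>v v - \<nu> \<cdot>\<^sub>v v"
proof -
  have "(\<nu> \<cdot>\<^sub>m 1\<^sub>m n) *\<^sub>v v = \<nu> \<cdot>\<^sub>v v"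
    using assms by (intro eq_vecI) auto
  then show ?thesis using assms by (simp add: minus_mult_distrib_mat_vec[of _ n n])
qed

section \<open>Powers of a matrix on chains and on eigenvectors\<close>

text \<open>Each application of B lowers the index by one. Truncated subtraction gives the right
  value also for i > j: the chain has then reached \<open>v 0\<close>, which is zero and stays
  there.\<close>

lemma pow_mat_mult_chain:
  assumes B: "B \<in> carrier_mat n n"
    and v: "\<And>j. j \<le> k \<Longrightarrow> v j \<in> carrier_vec n"
    and v0: "v 0 = 0\<^sub>v n"
    and step: "\<And>j. 1 \<le> j \<Longrightarrow> j \<le> k \<Longrightarrow> B *\<^sub>v v j = v (j - 1)"
  shows "j \<le> k \<Longrightarrow> B ^\<^sub>m i *\<^sub>v v j = v (j - i)"
proof (induction i arbitrary: j)
  case 0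
  then show ?case using B v by simp
next
  case (Suc i)
  \<comment> \<open>This extends \<open>step\<close> to j = 0, where j - 1 = 0 and B maps zero to
    zero, so that the induction needs no case distinction on whether the chain has ended.\<close>
  have *: "B *\<^sub>v v j = v (j - 1)"
    using step[of j] Suc.prems v0 B by (cases "j = 0") auto
  have "B ^\<^sub>m Suc i *\<^sub>v v j = B ^\<^sub>m i *\<^sub>v (B *\<^sub>v v j)"
    using B v[OF Suc.prems] by (simp add: assoc_mult_mat_vec[of _ n n _ n])
  also have "\<dots> = v (j - Suc i)"
    using Suc.IH[of "j - 1"] Suc.prems by (simp add: *)
  finally show ?case .
qed

lemma pow_mat_mult_eigen:
  fixes B :: "'a :: field mat"
  assumes B: "B \<in> carrier_mat n n" and v: "v \<in> carrier_vec n" and "B *\<^sub>v v = a \<cdot>\<^sub>v v"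
  shows "B ^\<^sub>m i *\<^sub>v v = a ^ i \<cdot>\<^sub>v v"
proof (induction i)
  case 0
  then show ?case using assms by simp
next
  case (Suc i)
  have "B ^\<^sub>m Suc i *\<^sub>v v = B ^\<^sub>m i *\<^sub>v (a \<cdot>\<^sub>v v)"
    using assms by (simp add: assoc_mult_mat_vec[of _ n n _ n])
  also have "\<dots> = a ^ Suc i \<cdot>\<^sub>v v"
    using Suc by (simp add: mult_mat_vec[OF pow_carrier_mat[OF B] v] smult_smult_assoc)
  finally show ?case .
qed

text \<open>Puts a Jordan chain into the lowering form that \<open>pow_mat_mult_chain\<close>
  expects. Index 0 is covered by the first claim because \<open>jordan_chain\<close> fixes
  \<open>x 0\<close> as the zero vector, and the second claim at j = 1 ends there.\<close>

lemma jordan_chain_shift: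
  assumes A: "A \<in> carrier_mat n n" and ch: "jordan_chain A \<nu> k x" and j: "j \<le> k"
  shows "x j \<in> carrier_vec n"
    and "1 \<le> j \<Longrightarrow> (A - \<nu> \<cdot>\<^sub>m 1\<^sub>m n) *\<^sub>v x j = x (j - 1)"
proof -
  have car: "x i \<in> carrier_vec n" if "i \<le> k" for i
    using ch A that
    by (cases "i = 0") (auto simp: jordan_chain_def generalized_eigenvector_def Let_def)
  then show "x j \<in> carrier_vec n" using j .
  assume "1 \<le> j"
  then have "A *\<^sub>v x j = \<nu> \<cdot>\<^sub>v x j + x (j - 1)" using ch j by (auto simp: jordan_chain_def)
  then show "(A - \<nu> \<cdot>\<^sub>m 1\<^sub>m n) *\<^sub>v x j = x (j - 1)"
    using car[OF j] carrier_vecD[OF car[of "j - 1"]] j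
    by (subst minus_smult_one_mult_vec[OF A car[OF j]]) (auto intro!: eq_vecI)
qed

section \<open>The recurrence as a comparison of coefficients\<close>

lemma chain_coeff_Suc_lt:
  assumes "1 \<le> j" "j < m"
  shows "chain_coeff d m p q (Suc t) j =
    d powi (int j - int m) *
      (chain_coeff d m p q (Suc t) m - (\<Sum>i<m - j. d ^ i * chain_coeff d m p q t (m - 1 - i)))"
  using assms by (simp add: Let_def)

lemma chain_coeff_Suc_top:
  "chain_coeff d m p q (Suc t) m =
    (d ^ m * (q (Suc t) - chain_coeff d m p q t m)
       - (\<Sum>j=1..m. p j * (\<Sum>i<m - j. d ^ (i + j) * chain_coeff d m p q t (m - 1 - i))))
    / (d ^ (m + 1) - (\<Sum>j=1..m. d ^ j * p j))"
  by (simp add: Let_def)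

declare chain_coeff.simps(2) [simp del]

text \<open>Multiplying by d^m clears the negative exponent j - m. The formula then also covers j =
  m, where the inner sum is empty, so both branches of the recursion can be treated alike.\<close>

lemma chain_coeff_scaled:
  assumes "d \<noteq> 0" "1 \<le> j" "j \<le> m"
  shows "d ^ m * chain_coeff d m p q (Suc t) j =
    d ^ j *
      (chain_coeff d m p q (Suc t) m - (\<Sum>i<m - j. d ^ i * chain_coeff d m p q t (m - 1 - i)))"
proof (cases "j = m")
  case False
  then have "j < m" using assms by simp
  have "d ^ m * d powi (int j - int m) = d ^ j"
    using assms(1) by (simp add: power_int_diff)
  then show ?thesis
    unfolding chain_coeff_Suc_lt[OF assms(2) \<open>j < m\<close>] mult.assoc[symmetric] by simp
qed simp

text \<open>This is the coefficient of x_j with j < m in B w_t = w_(t-1). It holds because the inner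
  sum for j exceeds the one for j + 1 by a single term, which contributes beta_j^(t-1).\<close>

lemma chain_coeff_shift:
  assumes d: "d \<noteq> 0" and j: "1 \<le> j" "j < m"
  shows "chain_coeff d m p q (Suc t) (Suc j) =
    chain_coeff d m p q t j + d * chain_coeff d m p q (Suc t) j"
proof -
  let ?b = "chain_coeff d m p q (Suc t)" and ?c = "chain_coeff d m p q t"
  have mj: "m - j = Suc (m - Suc j)" using j by simp
  have "d ^ m * ?b (Suc j) = d ^ Suc j * (?b m - (\<Sum>i<m - Suc j. d ^ i * ?c (m - 1 - i)))"
    using chain_coeff_scaled[of d "Suc j" m] d j by simp
  \<comment> \<open>The extra term has i = m - Suc j. Its power of d completes d^(Suc j) to d^m, and
    its coefficient index m - 1 - i is j.\<close>
  also have "\<dots> = d * (d ^ j * (?b m - (\<Sum>i<m - j. d ^ i * ?c (m - 1 - i))))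
      + d ^ (Suc j + (m - Suc j)) * ?c (m - 1 - (m - Suc j))"
    unfolding mj sum.lessThan_Suc by (simp add: algebra_simps power_add)
  also have "\<dots> = d * (d ^ m * ?b j) + d ^ m * ?c j"
    using d j by (subst chain_coeff_scaled) auto
  also have "\<dots> = d ^ m * (?c j + d * ?b j)" by (simp add: algebra_simps)
  finally show ?thesis using d by simp
qed

text \<open>This is the coefficient of x_m in B w_t = w_(t-1), the left side being b^* w_t. Once
  every beta_j^(t) is expressed through beta_m^(t), it becomes a linear equation for beta_m^(t), and
  the quotient in the recursion is its solution.\<close>

lemma chain_coeff_top:
  assumes d: "d \<noteq> 0" and den: "d ^ (m + 1) - (\<Sum>j=1..m. d ^ j * p j) \<noteq> 0"
  shows "q (Suc t) + (\<Sum>j=1..m. chain_coeff d m p q (Suc t) j * p j) =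
    chain_coeff d m p q t m + d * chain_coeff d m p q (Suc t) m"
proof -
  let ?b = "chain_coeff d m p q (Suc t)" and ?c = "chain_coeff d m p q t"
  let ?S = "\<Sum>j=1..m. p j * (\<Sum>i<m - j. d ^ (i + j) * ?c (m - 1 - i))"
  have "d ^ m * (\<Sum>j=1..m. ?b j * p j) = (\<Sum>j=1..m. (d ^ m * ?b j) * p j)"
    by (simp add: sum_distrib_left algebra_simps)
  also have "\<dots> = (\<Sum>j=1..m. (d ^ j * (?b m - (\<Sum>i<m - j. d ^ i * ?c (m - 1 - i)))) * p j)"
    using d by (intro sum.cong refl) (simp add: chain_coeff_scaled)
  \<comment> \<open>The factors d^j and d^i merge into d^(i+j), which turns the double sum into
    \<open>?S\<close>.\<close>
  also have "\<dots> = ?b m * (\<Sum>j=1..m. d ^ j * p j) - ?S"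
    by (simp add: algebra_simps sum_distrib_left sum_subtractf power_add)
  finally have 1: "d ^ m * (\<Sum>j=1..m. ?b j * p j) = ?b m * (\<Sum>j=1..m. d ^ j * p j) - ?S" .
  have 2: "?b m * (d ^ (m + 1) - (\<Sum>j=1..m. d ^ j * p j)) = d ^ m * (q (Suc t) - ?c m) - ?S"
    using den unfolding chain_coeff_Suc_top by simp
  \<comment> \<open>Inserting -\<open>?S\<close> + \<open>?S\<close> makes facts \<open>1\<close>
    and \<open>2\<close> applicable together; the multiples of the sum of d^j p_j then
    cancel.\<close>
  have "d ^ m * (q (Suc t) + (\<Sum>j=1..m. ?b j * p j)) =
      (d ^ m * (q (Suc t) - ?c m) - ?S) + d ^ m * ?c m + (d ^ m * (\<Sum>j=1..m. ?b j * p j) + ?S)"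
    by (simp add: algebra_simps)
  also have "\<dots> = d ^ m * (?c m + d * ?b m)"
    unfolding 1 2[symmetric] by (simp add: algebra_simps)
  finally have "d ^ m * (q (Suc t) + (\<Sum>j=1..m. ?b j * p j)) = d ^ m * (?c m + d * ?b m)" .
  then show ?thesis using d by simp
qed

text \<open>With X j a fixed coordinate of x_j, the factor X (j - 1) - d X j comes from A - mu I
  acting on x_j, and the last summand on the left is the contribution of x_m b^*. The relation
  between neighbouring coefficients makes everything collapse to the corresponding coordinate of the
  x-part of w_(t-1).\<close>

lemma sum_chain_telescope:
  fixes X :: "nat \<Rightarrow> 'a :: comm_ring_1"
  assumes X0: "X 0 = 0" and shift: "\<And>j. 1 \<le> j \<Longrightarrow> j < m \<Longrightarrow> \<beta> (Suc j) = c j + d * \<beta> j"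
  shows "(\<Sum>j=1..m. \<beta> j * (X (j - 1) - d * X j)) + (c m + d * \<beta> m) * X m = (\<Sum>j=1..m. c j * X j)"
  using shift
proof (induction m)
  case 0
  then show ?case using X0 by simp
next
  case (Suc m)
  have IH: "(\<Sum>j=1..m. \<beta> j * (X (j - 1) - d * X j)) + (c m + d * \<beta> m) * X m =
      (\<Sum>j=1..m. c j * X j)"
    using Suc by simp
  \<comment> \<open>For m > 0 this is the shift relation; for m = 0 both sides vanish with
    \<open>X 0\<close>. It turns the X m part of the new summand into the top term of the induction
    hypothesis.\<close>
  have "\<beta> (Suc m) * X m = (c m + d * \<beta> m) * X m"
    using Suc.prems[of m] X0 by (cases "m = 0") auto
  then show ?case using IH by (simp add: algebra_simps)
qed

section \<open>The chain of the perturbed matrix at mu\<close>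

theorem theorem3p8:
  fixes n r m \<gamma> :: nat
    and A :: "complex mat"
    and lam mu :: complex
    and b :: "complex vec"
    and x z :: "nat \<Rightarrow> complex vec"
    and \<beta> :: "nat \<Rightarrow> nat \<Rightarrow> complex"
  assumes "A \<in> carrier_mat n n"
    and "eigenvalue A lam"
    and "has_jordan_block A lam r"
    and "jordan_chain A lam r x"
    and "1 \<le> m" and "m \<le> r"
    and "b \<in> carrier_vec n"
    and "eigenvalue A mu"
    and "mu \<noteq> lam"
    and "has_jordan_block A mu \<gamma>"
    and "jordan_chain A mu \<gamma> z"
    and "(mu - lam) ^ (m + 1) - (\<Sum>j=1..m. (mu - lam) ^ j * (x j \<bullet>c b)) \<noteq> 0"
    and \<beta>: "\<beta> = chain_coeff (mu - lam) m (\<lambda>j. x j \<bullet>c b) (\<lambda>t. z t \<bullet>c b)"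
  shows "\<forall>t\<in>{1..\<gamma>}.
      generalized_eigenvector (A + rank_one (x m) b) mu t
        (z t + finsum_vec TYPE(complex) n (\<lambda>j. \<beta> t j \<cdot>\<^sub>v x j) {1..m})
    \<and> (\<forall>j\<in>{1..m - 1}. \<beta> t j =
        (mu - lam) powi (int j - int m) *
        (\<beta> t m - (\<Sum>i<m - j. (mu - lam) ^ i * \<beta> (t - 1) (m - 1 - i))))
    \<and> \<beta> t m =
        ((mu - lam) ^ m * (z t \<bullet>c b - \<beta> (t - 1) m)
          - (\<Sum>j=1..m. (x j \<bullet>c b) *
              (\<Sum>i<m - j. (mu - lam) ^ (i + j) * \<beta> (t - 1) (m - 1 - i))))
        / ((mu - lam) ^ (m + 1) - (\<Sum>j=1..m. (mu - lam) ^ j * (x j \<bullet>c b)))"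
proof -
  note A = assms(1) and chx = assms(4) and m = assms(5,6) and b = assms(7) and chz = assms(11)
    and den = assms(12)
  define d where "d = mu - lam"
  have d: "d \<noteq> 0" using assms(9) by (simp add: d_def)
  define p where "p = (\<lambda>j. x j \<bullet>c b)"
  define q where "q = (\<lambda>t. z t \<bullet>c b)"
  have \<beta>: "\<beta> = chain_coeff d m p q" using \<beta> by (simp add: d_def p_def q_def)
  have den: "d ^ (m + 1) - (\<Sum>j=1..m. d ^ j * p j) \<noteq> 0" using den by (simp add: d_def p_def)
  \<comment> \<open>The part of w_t in the span of x_1, ..., x_m is kept apart from z_t, since (A -
    lam I)^m annihilates the former but not z_1.\<close>
  define s where "s = (\<lambda>t. finsum_vec TYPE(complex) n (\<lambda>j. \<beta> t j \<cdot>\<^sub>v x j) {1..m})"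
  define w where "w = (\<lambda>t. z t + s t)"
  define B where "B = A + rank_one (x m) b - mu \<cdot>\<^sub>m 1\<^sub>m n"
  have xc: "x j \<in> carrier_vec n" if "j \<le> m" for j
    using jordan_chain_shift(1)[OF A chx] that m by simp
  have xd: "dim_vec (x j) = n" if "j \<le> m" for j using xc[OF that] by simp
  have zc: "z t \<in> carrier_vec n" if "t \<le> \<gamma>" for t
    using jordan_chain_shift(1)[OF A chz] that by simp
  have x0: "x 0 = 0\<^sub>v n" and z0: "z 0 = 0\<^sub>v n"
    using chx chz A by (auto simp: jordan_chain_def)
  have sc: "s t \<in> carrier_vec n" for t
    unfolding s_def using xc by (intro finsum_vec_closed) auto
  have wc: "w t \<in> carrier_vec n" if "t \<le> \<gamma>" for t
    unfolding w_def using zc[OF that] sc by simp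
  have R: "rank_one (x m) b \<in> carrier_mat n n" using xc b by simp
  have AR: "A + rank_one (x m) b \<in> carrier_mat n n" using A R by simp
  have Mc: "A - mu \<cdot>\<^sub>m 1\<^sub>m n \<in> carrier_mat n n"
    by (intro minus_carrier_mat smult_carrier_mat one_carrier_mat)
  have Bc: "B \<in> carrier_mat n n" unfolding B_def
    by (intro minus_carrier_mat smult_carrier_mat one_carrier_mat)
  have s_idx: "s t $ i = (\<Sum>j=1..m. \<beta> t j * x j $ i)" if "i < n" for t i
    using xc that unfolding s_def
    by (subst index_finsum_vec) (auto intro!: sum.cong simp: xd)
  \<comment> \<open>The default beta_j^(0) = 0 makes w_0 = 0, the vector in which the new chain
    ends.\<close>
  have s0: "s 0 = 0\<^sub>v n"
    using sc s_idx[of _ 0] by (intro eq_vecI) (auto simp: \<beta>)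
  have w0: "w 0 = 0\<^sub>v n" by (simp add: w_def s0 z0)

  \<comment> \<open>The relation B w_t = w_(t-1)\<close>
  have step: "B *\<^sub>v w t = w (t - 1)" if t: "1 \<le> t" "t \<le> \<gamma>" for t
  proof -
    obtain u where u: "t = Suc u" using t by (cases t) auto
    have cb: "conjugate b \<in> carrier_vec n" using b by simp
    have "w t \<bullet>c b = q t + (\<Sum>j=1..m. (\<beta> t j \<cdot>\<^sub>v x j) \<bullet>c b)"
    proof -
      have "s t \<bullet>c b = (\<Sum>j=1..m. (\<beta> t j \<cdot>\<^sub>v x j) \<bullet>c b)"
        unfolding s_def using xc by (intro finsum_vec_scalar_prod[OF cb]) auto
      then show ?thesis
        unfolding w_def q_def by (simp only: add_scalar_prod_distrib[OF zc[OF t(2)] sc cb])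
    qed
    also have "(\<Sum>j=1..m. (\<beta> t j \<cdot>\<^sub>v x j) \<bullet>c b) = (\<Sum>j=1..m. \<beta> t j * p j)"
      using xc b by (intro sum.cong) (auto simp: p_def)
    \<comment> \<open>This scalar is the factor with which the rank-one term adds x_m to B
      w_t.\<close>
    finally have wb: "w t \<bullet>c b = \<beta> u m + d * \<beta> t m"
      unfolding u \<beta> using chain_coeff_top[OF d den] by simp
    have "(A - mu \<cdot>\<^sub>m 1\<^sub>m n) *\<^sub>v w t = z u + (A - mu \<cdot>\<^sub>m 1\<^sub>m n) *\<^sub>v s t"
      unfolding w_def mult_add_distrib_mat_vec[OF Mc zc[OF t(2)] sc]
      using jordan_chain_shift(2)[OF A chz t(2) t(1)] u by simp
    also have "(A - mu \<cdot>\<^sub>m 1\<^sub>m n) *\<^sub>v s t =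
        finsum_vec TYPE(complex) n (\<lambda>j. (A - mu \<cdot>\<^sub>m 1\<^sub>m n) *\<^sub>v (\<beta> t j \<cdot>\<^sub>v x j)) {1..m}"
      unfolding s_def using xc by (intro mult_mat_vec_finsum_vec[OF Mc]) auto
    finally have Aw: "(A - mu \<cdot>\<^sub>m 1\<^sub>m n) *\<^sub>v w t = z u + \<dots>" .
    \<comment> \<open>From A x_j = lam x_j + x_(j-1) and lam - mu = -d, the matrix A - mu I maps x_j
      to x_(j-1) - d x_j.\<close>
    have summand: "((A - mu \<cdot>\<^sub>m 1\<^sub>m n) *\<^sub>v (\<beta> t j \<cdot>\<^sub>v x j)) $ i = \<beta> t j * (x (j - 1) $ i - d * x j $ i)"
      if ij: "i < n" "1 \<le> j" "j \<le> m" for i j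
    proof -
      have "A *\<^sub>v x j = lam \<cdot>\<^sub>v x j + x (j - 1)" using chx ij m by (auto simp: jordan_chain_def)
      then have "(A - mu \<cdot>\<^sub>m 1\<^sub>m n) *\<^sub>v (\<beta> t j \<cdot>\<^sub>v x j) =
          \<beta> t j \<cdot>\<^sub>v (lam \<cdot>\<^sub>v x j + x (j - 1) - mu \<cdot>\<^sub>v x j)"
        by (simp add: mult_mat_vec[OF Mc xc[OF ij(3)]] minus_smult_one_mult_vec[OF A xc[OF ij(3)]])
      then show ?thesis
        using ij by (simp add: xd d_def algebra_simps)
    qed
    have "B *\<^sub>v w t = (A - mu \<cdot>\<^sub>m 1\<^sub>m n) *\<^sub>v w t + (w t \<bullet>c b) \<cdot>\<^sub>v x m"
    proof -
      have "B = (A - mu \<cdot>\<^sub>m 1\<^sub>m n) + rank_one (x m) b"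
        unfolding B_def using A R by (intro eq_matI) auto
      then show ?thesis
        using rank_one_mult_vec[OF xc b wc[OF t(2)]]
        by (simp add: add_mult_distrib_mat_vec[OF Mc R wc[OF t(2)]])
    qed
    also have "\<dots> = w u"
    proof (rule eq_vecI)
      fix i assume "i < dim_vec (w u)"
      then have i: "i < n" using wc[of u] t u by simp
      \<comment> \<open>The scalar telescoping identity is taken at X j = \<open>x j $ i\<close>;
        its condition \<open>X 0 = 0\<close> is the convention x_0 = 0.\<close>
      have tel: "(\<Sum>j=1..m. \<beta> t j * (x (j - 1) $ i - d * x j $ i)) + (\<beta> u m + d * \<beta> t m) * x m $ i
          = (\<Sum>j=1..m. \<beta> u j * x j $ i)"
        unfolding u \<beta> using chain_coeff_shift[OF d] i x0
        by (intro sum_chain_telescope) auto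
      have fc: "(\<lambda>j. (A - mu \<cdot>\<^sub>m 1\<^sub>m n) *\<^sub>v (\<beta> t j \<cdot>\<^sub>v x j)) \<in> {1..m} \<rightarrow> carrier_vec n"
        using xc by (auto intro!: mult_mat_vec_carrier[OF Mc])
      have "finsum_vec TYPE(complex) n (\<lambda>j. (A - mu \<cdot>\<^sub>m 1\<^sub>m n) *\<^sub>v (\<beta> t j \<cdot>\<^sub>v x j)) {1..m} $ i
          = (\<Sum>j=1..m. \<beta> t j * (x (j - 1) $ i - d * x j $ i))"
        using fc i summand by (subst index_finsum_vec) (auto intro!: sum.cong)
      then show "((A - mu \<cdot>\<^sub>m 1\<^sub>m n) *\<^sub>v w t + (w t \<bullet>c b) \<cdot>\<^sub>v x m) $ i = w u $ i"
        unfolding Aw wb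
        using tel i carrier_vecD[OF finsum_vec_closed[OF fc]] xc[of m] carrier_vecD[OF sc] s_idx[OF i, of u]
        by (simp add: w_def algebra_simps)
    qed (use wc[of u] xc[of m] t u in auto)
    finally show ?thesis using u by simp
  qed

  \<comment> \<open>Nonvanishing of w_1\<close>
  have w1: "w 1 \<noteq> 0\<^sub>v n" if g: "1 \<le> \<gamma>"
  proof
    assume 0: "w 1 = 0\<^sub>v n"
    let ?L = "A - lam \<cdot>\<^sub>m 1\<^sub>m n"
    have L: "?L \<in> carrier_mat n n"
      by (intro minus_carrier_mat smult_carrier_mat one_carrier_mat)
    have Lm: "?L ^\<^sub>m m \<in> carrier_mat n n" using L by (rule pow_carrier_mat)
    have z1: "z 1 \<in> carrier_vec n" "z 1 \<noteq> 0\<^sub>v n" "A *\<^sub>v z 1 = mu \<cdot>\<^sub>v z 1"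
    proof -
      \<comment> \<open>Rank 1 involves the power k - 1 = 0, the identity, and so says that z_1 is
        nonzero; z_0 = 0 turns the chain relation into the eigenvalue equation.\<close>
      have "generalized_eigenvector A mu 1 (z 1)" "A *\<^sub>v z 1 = mu \<cdot>\<^sub>v z 1 + z 0"
        using chz g by (auto simp: jordan_chain_def)
      then show "z 1 \<in> carrier_vec n" "z 1 \<noteq> 0\<^sub>v n" "A *\<^sub>v z 1 = mu \<cdot>\<^sub>v z 1"
        using zc[OF g] z0 A by (auto simp: generalized_eigenvector_def Let_def)
    qed
    \<comment> \<open>For j at most m the truncated index j - m is 0, so m applications lead to x_0
      = 0.\<close>
    have Lx: "?L ^\<^sub>m m *\<^sub>v x j = 0\<^sub>v n" if "j \<le> m" for j
      using pow_mat_mult_chain[OF L, of m x j m] xc x0 that jordan_chain_shift(2)[OF A chx] m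
      by simp
    have "?L ^\<^sub>m m *\<^sub>v s 1 =
        finsum_vec TYPE(complex) n (\<lambda>j. ?L ^\<^sub>m m *\<^sub>v (\<beta> 1 j \<cdot>\<^sub>v x j)) {1..m}"
      unfolding s_def using xc by (intro mult_mat_vec_finsum_vec[OF Lm]) auto
    also have "\<dots> = 0\<^sub>v n"
    proof -
      have *: "?L ^\<^sub>m m *\<^sub>v (\<beta> 1 j \<cdot>\<^sub>v x j) = 0\<^sub>v n" if "j \<in> {1..m}" for j
        using that Lx[of j] xc[of j] by (subst mult_mat_vec[OF Lm]) auto
      show ?thesis
      proof (rule eq_vecI)
        fix i assume i: "i < dim_vec (0\<^sub>v n :: complex vec)"
        then show "finsum_vec TYPE(complex) n (\<lambda>j. ?L ^\<^sub>m m *\<^sub>v (\<beta> 1 j \<cdot>\<^sub>v x j)) {1..m} $ i = 0\<^sub>v n $ i"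
          using * by (subst index_finsum_vec) auto
      next
        show "dim_vec (finsum_vec TYPE(complex) n (\<lambda>j. ?L ^\<^sub>m m *\<^sub>v (\<beta> 1 j \<cdot>\<^sub>v x j)) {1..m})
            = dim_vec (0\<^sub>v n :: complex vec)"
          using * carrier_vecD[OF finsum_vec_closed, of "\<lambda>j. ?L ^\<^sub>m m *\<^sub>v (\<beta> 1 j \<cdot>\<^sub>v x j)" "{1..m}" n]
          by simp
      qed
    qed
    finally have Ls: "?L ^\<^sub>m m *\<^sub>v s 1 = 0\<^sub>v n" .
    have "?L *\<^sub>v z 1 = d \<cdot>\<^sub>v z 1"
      using z1 A by (simp add: minus_smult_one_mult_vec d_def) (auto simp: algebra_simps)
    from pow_mat_mult_eigen[OF L z1(1) this]
    have Lz: "?L ^\<^sub>m m *\<^sub>v z 1 = d ^ m \<cdot>\<^sub>v z 1" .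
    have "?L ^\<^sub>m m *\<^sub>v w 1 = d ^ m \<cdot>\<^sub>v z 1"
      unfolding w_def using z1(1) Lz Ls by (simp add: mult_add_distrib_mat_vec[OF Lm _ sc])
    moreover have "?L ^\<^sub>m m *\<^sub>v w 1 = 0\<^sub>v n"
      unfolding 0 using Lm by (intro eq_vecI) (auto simp: scalar_prod_def)
    ultimately have "d ^ m \<cdot>\<^sub>v z 1 = 0\<^sub>v n" by simp
    then have "z 1 = 0\<^sub>v n"
      using d z1(1) by (auto simp: vec_eq_iff)
    then show False using z1(2) by simp
  qed

  \<comment> \<open>The rank of w_t\<close>
  have gen: "generalized_eigenvector (A + rank_one (x m) b) mu t (w t)" if t: "1 \<le> t" "t \<le> \<gamma>" for t
  proof -
    have "B ^\<^sub>m i *\<^sub>v w t = w (t - i)" for i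
      using pow_mat_mult_chain[OF Bc, of \<gamma> w t i] wc w0 step t by simp
    \<comment> \<open>The two powers lower the index t to t - t = 0 and to t - (t - 1) = 1, that is,
      to w_0 = 0 and to the nonzero w_1.\<close>
    from this[of t] this[of "t - 1"]
    have "B ^\<^sub>m t *\<^sub>v w t = 0\<^sub>v n" "B ^\<^sub>m (t - 1) *\<^sub>v w t \<noteq> 0\<^sub>v n"
      using w0 w1 t by auto
    then show ?thesis
      using AR wc[OF t(2)] R unfolding generalized_eigenvector_def Let_def B_def by simp
  qed

  show ?thesis
  proof (intro ballI conjI)
    fix t assume t: "t \<in> {1..\<gamma>}"
    \<comment> \<open>The two formulas for the coefficients are the recursion equations of
      \<open>chain_coeff\<close>, which are stated at a successor.\<close>
    then obtain u where u: "t = Suc u" by (cases t) auto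
    show "generalized_eigenvector (A + rank_one (x m) b) mu t
        (z t + finsum_vec TYPE(complex) n (\<lambda>j. \<beta> t j \<cdot>\<^sub>v x j) {1..m})"
      using gen[of t] t by (simp add: w_def s_def)
    show "\<beta> t m =
        ((mu - lam) ^ m * (z t \<bullet>c b - \<beta> (t - 1) m)
          - (\<Sum>j=1..m. (x j \<bullet>c b) *
              (\<Sum>i<m - j. (mu - lam) ^ (i + j) * \<beta> (t - 1) (m - 1 - i))))
        / ((mu - lam) ^ (m + 1) - (\<Sum>j=1..m. (mu - lam) ^ j * (x j \<bullet>c b)))"
      unfolding u \<beta> using chain_coeff_Suc_top[of d m p q u] by (simp only: d_def p_def q_def diff_Suc_1)
    fix j assume "j \<in> {1..m - 1}"
    then have "1 \<le> j" "j < m" by auto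
    then show "\<beta> t j =
        (mu - lam) powi (int j - int m) *
        (\<beta> t m - (\<Sum>i<m - j. (mu - lam) ^ i * \<beta> (t - 1) (m - 1 - i)))"
      unfolding u \<beta> using chain_coeff_Suc_lt[of j m d p q u] by (simp only: d_def diff_Suc_1)
  qed
qed

end
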